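(* Let $a,m$ be integers with $1<a<m$ and $\gcd(a,m)=1$, and let $$\Lambda(a,m)=\{(x,y)\in\mathbb Z\times\mathbb Z \mid ax+y\equiv 0 \pmod m\}\subset\mathbb R^2.$$ Then there exists an s-state $\widehat{\mathcal X}_k=\begin{pmatrix}\widehat{v_1}^{(k)}\\ \widehat{v_2}^{(k)}\end{pmatrix}$ ($0\le k\le N$) of Qin's algorithm on input $(a,m)$ such that the set $$\{\widehat{v_1}^{(k)},\ \widehat{v_2}^{(k)},\ \widehat{v_1}^{(k)}+\widehat{v_2}^{(k)},\ \widehat{v_1}^{(k)}-\widehat{v_2}^{(k)}\}$$ contains a shortest vector of $\Lambda(a,m)$.
   Context: Qin's algorithm on input $(a,m)$ (integers, $1<a<m$, $\gcd(a,m)=1$) produces a finite sequence of states $\mathcal X_k=\begin{pmatrix}x_{11}^{(k)}&x_{12}^{(k)}\\ x_{21}^{(k)}&x_{22}^{(k)}\end{pmatrix}$ as follows. The initial state is $\mathcal X_0=\begin{pmatrix}1&a\\0&m\end{pmatrix}$. For $k\ge 1$, as long as $x_{12}^{(k-1)}\neq 1$, step $k$ produces $\mathcal X_k$ from $\mathcal X_{k-1}$: (i) if $x_{22}^{(k-1)}>x_{12}^{(k-1)}$, set $q_k=\left\lfloor \frac{x_{22}^{(k-1)}-1}{x_{12}^{(k-1)}}\right\rfloor$, $x_{21}^{(k)}=x_{21}^{(k-1)}+q_kx_{11}^{(k-1)}$, $x_{22}^{(k)}=x_{22}^{(k-1)}-q_kx_{12}^{(k-1)}$, and leave the first row unchanged;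 (ii) if $x_{12}^{(k-1)}>x_{22}^{(k-1)}$, set $q_k=\left\lfloor \frac{x_{12}^{(k-1)}-1}{x_{22}^{(k-1)}}\right\rfloor$, $x_{11}^{(k)}=x_{11}^{(k-1)}+q_kx_{21}^{(k-1)}$, $x_{12}^{(k)}=x_{12}^{(k-1)}-q_kx_{22}^{(k-1)}$, and leave the second row unchanged. The algorithm stops at the first index $N$ with $x_{12}^{(N)}=1$; $N$ is the number of steps. The s-state at step $k$ is $\widehat{\mathcal X}_k=\begin{pmatrix}x_{11}^{(k)}&-x_{12}^{(k)}\\ x_{21}^{(k)}&x_{22}^{(k)}\end{pmatrix}$, with row vectors $\widehat{v_1}^{(k)}=(x_{11}^{(k)},-x_{12}^{(k)})$ and $\widehat{v_2}^{(k)}=(x_{21}^{(k)},x_{22}^{(k)})$. A shortest vector of a lattice is a nonzero lattice vector of minimal Euclidean norm among nonzero lattice vectors. *)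

theory Defs
  imports "HOL-Analysis.Analysis" "HOL-Number_Theory.Cong"
begin

text \<open>
  Points of the plane have type \<^typ>\<open>real \<times> real\<close>, whose library norm is the Euclidean one.
\<close>

definition cong_lattice :: "int \<Rightarrow> int \<Rightarrow> (real \<times> real) set" where
  "cong_lattice a m = {(real_of_int x, real_of_int y) | x y. [a * x + y = 0] (mod m)}"

definition is_shortest_vector :: "'a::euclidean_space set \<Rightarrow> 'a \<Rightarrow> bool" where
  "is_shortest_vector L v \<longleftrightarrow>
     v \<in> L \<and> v \<noteq> 0 \<and> (\<forall>w\<in>L. w \<noteq> 0 \<longrightarrow> norm v \<le> norm w)"

text \<open>The states of Qin's algorithm are integral 2 by 2 matrices, listed row by row.\<close>

datatype qin_mat = Qin_Mat (x11: int) (x12: int) (x21: int) (x22: int)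

text \<open>
  One step of the algorithm. The final branch returns its argument unchanged; it covers a stopped
  run (\<open>x12 X = 1\<close>) as well as \<open>x12 X = x22 X \<noteq> 1\<close>, which does not occur for coprime input. On
  integers, \<open>div\<close> is the floor of the quotient.
\<close>

definition qin_step :: "qin_mat \<Rightarrow> qin_mat" where
  "qin_step X =
     (if x12 X \<noteq> 1 \<and> x22 X > x12 X then
        (let q = (x22 X - 1) div x12 X
         in Qin_Mat (x11 X) (x12 X) (x21 X + q * x11 X) (x22 X - q * x12 X))
      else if x12 X \<noteq> 1 \<and> x12 X > x22 X then
        (let q = (x12 X - 1) div x22 X
         in Qin_Mat (x11 X + q * x21 X) (x12 X - q * x22 X) (x21 X) (x22 X))
      else X)"

primrec qin_state :: "int \<Rightarrow> int \<Rightarrow> nat \<Rightarrow> qin_mat" where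
  "qin_state a m 0 = Qin_Mat 1 a 0 m"
| "qin_state a m (Suc k) = qin_step (qin_state a m k)"

text \<open>
  The number of steps N, i.e. the first index with \<open>x12 = 1\<close>. The states of the run are the
  \<open>qin_state a m k\<close> with \<open>k \<le> N\<close>. Such an index exists by \<open>qin_terminates\<close> below.
\<close>

definition qin_steps :: "int \<Rightarrow> int \<Rightarrow> nat" where
  "qin_steps a m = (LEAST k. x12 (qin_state a m k) = 1)"

text \<open>The rows of the s-state belonging to a state.\<close>

definition s_row1 :: "qin_mat \<Rightarrow> real \<times> real" where
  "s_row1 X = (real_of_int (x11 X), - real_of_int (x12 X))"

definition s_row2 :: "qin_mat \<Rightarrow> real \<times> real" where
  "s_row2 X = (real_of_int (x21 X), real_of_int (x22 X))"

lemma qin_quotient_bounds: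
  fixes b c :: int
  assumes "0 < b" "b < c"
  shows "0 < c - (c - 1) div b * b" "c - (c - 1) div b * b < c"
proof -
  have "(c - 1) div b * b \<le> c - 1"
    using assms by (metis div_mult_mod_eq le_add_same_cancel1 pos_mod_sign)
  then show "0 < c - (c - 1) div b * b" by linarith
  have "0 < (c - 1) div b"
    using assms by (simp add: pos_imp_zdiv_pos_iff)
  then show "c - (c - 1) div b * b < c"
    using assms by simp
qed

lemma gcd_diff_mult_int: "gcd b (c - q * b) = gcd b (c :: int)"
  using gcd_add_mult[of b "- q" c] by (simp add: algebra_simps)

lemma qin_step_invariant:
  assumes "0 < x12 X" "0 < x22 X" "coprime (x12 X) (x22 X)" "x12 X \<noteq> 1"
  shows "0 < x12 (qin_step X)" "0 < x22 (qin_step X)"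
    "coprime (x12 (qin_step X)) (x22 (qin_step X))"
    "x12 (qin_step X) + x22 (qin_step X) < x12 X + x22 X"
proof -
  have ne: "x12 X \<noteq> x22 X"
    using assms by auto
  have "0 < x12 (qin_step X) \<and> 0 < x22 (qin_step X) \<and>
      coprime (x12 (qin_step X)) (x22 (qin_step X)) \<and>
      x12 (qin_step X) + x22 (qin_step X) < x12 X + x22 X"
  proof (cases "x12 X < x22 X")
    case True
    then show ?thesis
      using assms qin_quotient_bounds[of "x12 X" "x22 X"]
      by (simp add: qin_step_def Let_def coprime_iff_gcd_eq_1 gcd_diff_mult_int)
  next
    case False
    with ne have "x22 X < x12 X" by simp
    then show ?thesis
      using assms qin_quotient_bounds[of "x22 X" "x12 X"]
        gcd_diff_mult_int[of "x22 X" "x12 X" "(x12 X - 1) div x22 X"]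
      by (simp add: qin_step_def Let_def coprime_iff_gcd_eq_1 gcd.commute)
  qed
  then show "0 < x12 (qin_step X)" "0 < x22 (qin_step X)"
    "coprime (x12 (qin_step X)) (x22 (qin_step X))"
    "x12 (qin_step X) + x22 (qin_step X) < x12 X + x22 X" by auto
qed

lemma qin_terminates:
  assumes "1 < a" "a < m" "coprime a m"
  shows "\<exists>k. x12 (qin_state a m k) = 1"
proof (rule ccontr)
  assume "\<not> ?thesis"
  then have ne: "x12 (qin_state a m k) \<noteq> 1" for k by blast
  have "0 < x12 (qin_state a m k) \<and> 0 < x22 (qin_state a m k) \<and>
      coprime (x12 (qin_state a m k)) (x22 (qin_state a m k)) \<and>
      x12 (qin_state a m k) + x22 (qin_state a m k) \<le> a + m - int k" for k
  proof (induction k)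
    case 0
    show ?case using assms by simp
  next
    case (Suc k)
    then show ?case
      using qin_step_invariant[of "qin_state a m k"] ne[of k] by simp
  qed
  from this[of "nat (a + m)"] show False
    using assms by auto
qed

end

theory Submission
  imports Defs
begin

text \<open>
  Both rows of an s-state lie in the lattice, and they form a basis of it because each step keeps
  their determinant equal to \<open>m\<close> (\<open>lattice_coordinates\<close>).
  The first row points into the lower right quadrant and the second one into the upper right
  quadrant. Along the run the first coordinates grow and the second ones shrink in absolute value,
  so the inner product of the two rows starts at \<open>- a * m < 0\<close> and increases.

  A step adds one row \<open>u\<close> to the other row \<open>w\<close> several times, say \<open>q\<close> times. In the step in which
  the inner product becomes nonnegative, there are consecutive vectors \<open>w + j * u\<close> and
  \<open>w + (j + 1) * u\<close> between which the inner product with \<open>u\<close> changes sign. These two vectors still lie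
  in one quadrant, so their own inner product is nonnegative as well, and Selling's reduction
  criterion (\<open>selling_reduced\<close>) says that \<open>u\<close>, \<open>w + j * u\<close> or \<open>w + (j + 1) * u\<close> is a shortest vector.
  The vectors \<open>w + i * u\<close> with \<open>0 < i < q\<close> are not rows of any state, but both of their coordinates
  are at least as large in absolute value as those of \<open>u\<close>. Hence \<open>u\<close>, \<open>w\<close> or \<open>w + q * u\<close> is shortest
  (\<open>sign_change_dominates\<close>), and these are rows of the state before or after the step.

  If the inner product is still negative when the run stops, the same argument applies to one further
  step, which would lower the second coordinate of the second row to \<open>1\<close>; the new row that it would
  produce is no shorter than the first row (\<open>last_state_dominates\<close>).
\<close>

section \<open>Reduced superbases in the plane\<close>

text \<open>
  Selling's formula writes the squared norm as a combination of \<open>x\<^sup>2\<close>, \<open>y\<^sup>2\<close> and \<open>(x - y)\<^sup>2\<close> with the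
  nonnegative coefficients \<open>u \<bullet> (u + w)\<close>, \<open>w \<bullet> (u + w)\<close> and \<open>- (u \<bullet> w)\<close>. Since \<open>x\<close> and \<open>y\<close> are
  not both \<open>0\<close>, at most one of the three squares vanishes, and the squared norms of \<open>u\<close>, \<open>w\<close> and \<open>u + w\<close> are the sums of two coefficients.
\<close>

lemma selling_reduced:
  fixes u w :: "'a::real_inner" and x y :: int
  assumes "u \<bullet> w \<le> 0" "0 \<le> u \<bullet> (u + w)" "0 \<le> w \<bullet> (u + w)" "x \<noteq> 0 \<or> y \<noteq> 0"
  shows "\<exists>v\<in>{u, w, u + w}. norm v \<le> norm (real_of_int x *\<^sub>R u + real_of_int y *\<^sub>R w)"
proof -
  define A B C where "A = u \<bullet> (u + w)" and "B = w \<bullet> (u + w)" and "C = - (u \<bullet> w)"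
  let ?z = "real_of_int x *\<^sub>R u + real_of_int y *\<^sub>R w"
  have nonneg: "0 \<le> A" "0 \<le> B" "0 \<le> C"
    using assms by (auto simp: A_def B_def C_def)
  have norms: "u \<bullet> u = A + C" "w \<bullet> w = B + C" "(u + w) \<bullet> (u + w) = A + B"
    by (simp_all add: A_def B_def C_def inner_add inner_commute)
  have selling: "?z \<bullet> ?z = A * (real_of_int x)\<^sup>2 + B * (real_of_int y)\<^sup>2 + C * (real_of_int (x - y))\<^sup>2"
    by (simp add: A_def B_def C_def inner_add inner_commute power2_eq_square algebra_simps)
  have ge: "c \<le> c * (real_of_int n)\<^sup>2" if "0 \<le> c" "n \<noteq> 0" for c n
  proof -
    have "1 \<le> n\<^sup>2" using that by (simp add: int_one_le_iff_zero_less)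
    then have "1 \<le> (real_of_int n)\<^sup>2" by (metis of_int_1_le_iff of_int_power)
    then show ?thesis using that by (simp add: mult_le_cancel_left1)
  qed
  have ge0: "0 \<le> c * (real_of_int n)\<^sup>2" if "0 \<le> c" for c n
    using that by simp
  consider "x \<noteq> 0" "y \<noteq> 0" | "x \<noteq> 0" "x - y \<noteq> 0" | "y \<noteq> 0" "x - y \<noteq> 0"
    using assms(4) by force
  then have "\<exists>v\<in>{u, w, u + w}. v \<bullet> v \<le> ?z \<bullet> ?z"
  proof cases
    case 1
    then have "(u + w) \<bullet> (u + w) \<le> ?z \<bullet> ?z"
      using ge[OF nonneg(1), of x] ge[OF nonneg(2), of y] ge0[OF nonneg(3), of "x - y"]
      unfolding selling norms by linarith
    then show ?thesis by blast
  next
    case 2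
    then have "u \<bullet> u \<le> ?z \<bullet> ?z"
      using ge[OF nonneg(1), of x] ge[OF nonneg(3), of "x - y"] ge0[OF nonneg(2), of y]
      unfolding selling norms by linarith
    then show ?thesis by blast
  next
    case 3
    then have "w \<bullet> w \<le> ?z \<bullet> ?z"
      using ge[OF nonneg(2), of y] ge[OF nonneg(3), of "x - y"] ge0[OF nonneg(1), of x]
      unfolding selling norms by linarith
    then show ?thesis by blast
  qed
  then show ?thesis by (simp add: norm_le)
qed

lemma norm_Pair_mono:
  fixes b c b' c' :: real
  assumes "\<bar>b\<bar> \<le> \<bar>b'\<bar>" "\<bar>c\<bar> \<le> \<bar>c'\<bar>"
  shows "norm (b, c) \<le> norm (b', c')"
  using assms by (auto simp: norm_Pair intro!: add_mono simp: abs_le_square_iff)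

text \<open>
  At the sign change, two consecutive vectors \<open>w + j * u\<close> and \<open>w + (j + 1) * u\<close> form a reduced superbase
  with \<open>u\<close>. As \<open>s - n * r\<close> stays nonnegative, an intermediate vector has a second coordinate of at
  least \<open>r\<close> and a first coordinate of at least \<open>p\<close>, so \<open>u\<close> can take its place.
\<close>

lemma sign_change_dominates:
  fixes p r t s :: real and x y :: int and n :: nat
  defines "u \<equiv> (p, - r)" and "w \<equiv> (t, s)"
  assumes nonneg: "0 \<le> p" "0 \<le> t" "0 \<le> r" and quadrant: "n * r \<le> s"
    and neg: "w \<bullet> u < 0" and pos: "0 \<le> (w + real n *\<^sub>R u) \<bullet> u"
    and xy: "x \<noteq> 0 \<or> y \<noteq> 0"
  shows "\<exists>v\<in>{u, w, w + real n *\<^sub>R u}. norm v \<le> norm (real_of_int x *\<^sub>R u + real_of_int y *\<^sub>R w)"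
proof -
  let ?z = "real_of_int x *\<^sub>R u + real_of_int y *\<^sub>R w"
  define W where "W i = w + real i *\<^sub>R u" for i
  have W_Suc: "W (Suc i) = u + W i" for i
    by (simp add: W_def algebra_simps)
  have W_eq: "W i = (t + i * p, s - i * r)" for i
    by (simp add: W_def u_def w_def)
  obtain j where j: "j < n" "W j \<bullet> u < 0" "0 \<le> W (Suc j) \<bullet> u"
    using ex_least_nat_less[of "\<lambda>i. 0 \<le> W i \<bullet> u" n] neg pos by (force simp: W_def not_le)
  have below: "i * r \<le> s" if "i \<le> n" for i
    using quadrant nonneg mult_right_mono[of "real i" "real n" r] that by simp
  have "0 \<le> W j \<bullet> W (Suc j)"
    using nonneg below[of j] below[of "Suc j"] j(1) unfolding W_eq inner_Pair inner_real_def
    by (intro add_nonneg_nonneg mult_nonneg_nonneg) auto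
  \<comment> \<open>The coordinates of \<open>?z\<close> change when the basis vector \<open>w\<close> is replaced by \<open>W j\<close>.\<close>
  moreover have "?z = real_of_int (x - int j * y) *\<^sub>R u + real_of_int y *\<^sub>R W j"
    by (simp add: W_def algebra_simps)
  moreover have "x - int j * y \<noteq> 0 \<or> y \<noteq> 0"
    using xy by auto
  ultimately have dom: "\<exists>v\<in>{u, W j, W (Suc j)}. norm v \<le> norm ?z"
    using j selling_reduced[of u "W j" "x - int j * y" y] by (simp add: W_Suc inner_commute)
  have inner_points: "norm u \<le> norm (W i)" if "i \<noteq> 0" "i < n" for i
  proof -
    have "p \<le> t + i * p"
      using nonneg that mult_right_mono[of 1 "real i" p] by simp
    moreover have "r \<le> s - i * r"
      using below[of "Suc i"] that by (simp add: algebra_simps)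
    ultimately show ?thesis
      unfolding W_eq u_def using nonneg by (intro norm_Pair_mono) auto
  qed
  have "\<exists>v\<in>{u, w, W n}. norm v \<le> norm (W i)" if "i \<le> n" for i
    using inner_points[of i] that by (cases "i = 0"; cases "i = n") (auto simp: W_def)
  with dom j(1) have "\<exists>v\<in>{u, w, W n}. norm v \<le> norm ?z"
    by (smt (verit) Suc_leI insertE insertI1 le_eq_less_or_eq order_trans singletonD)
  then show ?thesis by (simp add: W_def)
qed

section \<open>The rows of a state as a lattice basis\<close>

definition qin_invariant :: "int \<Rightarrow> int \<Rightarrow> qin_mat \<Rightarrow> bool" where
  "qin_invariant a m X \<longleftrightarrow>
     0 \<le> x11 X \<and> 0 \<le> x21 X \<and> 0 < x12 X \<and> 0 < x22 X \<and> coprime (x12 X) (x22 X) \<and>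
     x11 X * x22 X + x21 X * x12 X = m \<and> m dvd a * x11 X - x12 X \<and> m dvd a * x21 X + x22 X"

lemma qin_step_row2:
  assumes "x12 X \<noteq> 1" "x12 X < x22 X"
  shows "qin_step X = Qin_Mat (x11 X) (x12 X)
    (x21 X + (x22 X - 1) div x12 X * x11 X) (x22 X - (x22 X - 1) div x12 X * x12 X)"
  using assms by (simp add: qin_step_def Let_def)

lemma qin_step_row1:
  assumes "x12 X \<noteq> 1" "x22 X < x12 X"
  shows "qin_step X = Qin_Mat (x11 X + (x12 X - 1) div x22 X * x21 X)
    (x12 X - (x12 X - 1) div x22 X * x22 X) (x21 X) (x22 X)"
  using assms by (simp add: qin_step_def Let_def)

lemma qin_invariant_ne:
  assumes "qin_invariant a m X" "x12 X \<noteq> 1"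
  shows "x12 X \<noteq> x22 X"
  using assms by (auto simp: qin_invariant_def)

lemma qin_invariant_step:
  assumes inv: "qin_invariant a m X"
  shows "qin_invariant a m (qin_step X)"
proof (cases "x12 X = 1")
  case True
  then show ?thesis using inv by (simp add: qin_step_def)
next
  case ne: False
  note I = inv[unfolded qin_invariant_def]
  have pos: "0 < x12 (qin_step X)" "0 < x22 (qin_step X)" "coprime (x12 (qin_step X)) (x22 (qin_step X))"
    using qin_step_invariant[of X] I ne by auto
  show ?thesis
  proof (cases "x12 X < x22 X")
    case True
    define q where "q = (x22 X - 1) div x12 X"
    note step = qin_step_row2[OF ne True, folded q_def]
    have "0 \<le> q" using I by (simp add: q_def pos_imp_zdiv_nonneg_iff)
    moreover have "m dvd (a * x21 X + x22 X) + q * (a * x11 X - x12 X)"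
      by (rule dvd_add[OF _ dvd_mult]) (use I in blast)+
    ultimately show ?thesis
      using I pos by (simp add: qin_invariant_def step algebra_simps)
  next
    case False
    then have lt: "x22 X < x12 X" using qin_invariant_ne[OF inv ne] by simp
    define q where "q = (x12 X - 1) div x22 X"
    note step = qin_step_row1[OF ne lt, folded q_def]
    have "0 \<le> q" using I by (simp add: q_def pos_imp_zdiv_nonneg_iff)
    moreover have "m dvd (a * x11 X - x12 X) + q * (a * x21 X + x22 X)"
      by (rule dvd_add[OF _ dvd_mult]) (use I in blast)+
    ultimately show ?thesis
      using I pos by (simp add: qin_invariant_def step algebra_simps)
  qed
qed

lemma qin_invariant_state:
  assumes "1 < a" "a < m" "coprime a m"
  shows "qin_invariant a m (qin_state a m k)"
proof (induction k)
  case 0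
  show ?case using assms by (simp add: qin_invariant_def)
next
  case (Suc k)
  then show ?case by (simp add: qin_invariant_step)
qed

lemma rows_in_lattice:
  assumes "qin_invariant a m X"
  shows "s_row1 X \<in> cong_lattice a m - {0}" "s_row2 X \<in> cong_lattice a m - {0}"
proof -
  have "s_row1 X = (real_of_int (x11 X), real_of_int (- x12 X))"
    by (simp add: s_row1_def)
  moreover have "[a * x11 X + - x12 X = 0] (mod m)" "[a * x21 X + x22 X = 0] (mod m)"
    using assms by (simp_all add: qin_invariant_def cong_0_iff)
  ultimately have "s_row1 X \<in> cong_lattice a m" "s_row2 X \<in> cong_lattice a m"
    unfolding cong_lattice_def s_row2_def by blast+
  then show "s_row1 X \<in> cong_lattice a m - {0}" "s_row2 X \<in> cong_lattice a m - {0}"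
    using assms by (auto simp: qin_invariant_def s_row1_def s_row2_def zero_prod_def)
qed

text \<open>
  The determinant of the rows is \<open>m\<close>. By Cramer's rule the coordinates of a lattice vector are
  therefore quotients by \<open>m\<close>, and the congruences for the rows make both numerators divisible by \<open>m\<close>.
\<close>

lemma lattice_coordinates:
  assumes inv: "qin_invariant a m X" and z: "z \<in> cong_lattice a m - {0}"
  obtains x y :: int where "z = real_of_int x *\<^sub>R s_row1 X + real_of_int y *\<^sub>R s_row2 X" "x \<noteq> 0 \<or> y \<noteq> 0"
proof -
  note I = inv[unfolded qin_invariant_def]
  have det: "x11 X * x22 X + x21 X * x12 X = m" using I by blast
  have m: "m \<noteq> 0"
  proof
    assume "m = 0"
    with I have "x11 X * x22 X = 0" "x21 X * x12 X = 0" "a * x11 X = x12 X"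
      using add_nonneg_eq_0_iff[of "x11 X * x22 X" "x21 X * x12 X"] by auto
    with I show False by auto
  qed
  obtain b c :: int where bc: "z = (real_of_int b, real_of_int c)" "m dvd a * b + c"
    using z by (auto simp: cong_lattice_def cong_0_iff)
  have "m dvd b * (a * x21 X + x22 X) - x21 X * (a * b + c)"
    by (rule dvd_diff[OF dvd_mult dvd_mult]) (use I bc in blast)+
  then have "m dvd b * x22 X - c * x21 X" by (simp add: algebra_simps)
  then obtain x where x: "b * x22 X - c * x21 X = m * x" by (elim dvdE)
  have "m dvd x11 X * (a * b + c) - b * (a * x11 X - x12 X)"
    by (rule dvd_diff[OF dvd_mult dvd_mult]) (use I bc in blast)+
  then have "m dvd b * x12 X + c * x11 X" by (simp add: algebra_simps)
  then obtain y where y: "b * x12 X + c * x11 X = m * y" by (elim dvdE)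
  have "m * b = x11 X * (b * x22 X - c * x21 X) + x21 X * (b * x12 X + c * x11 X)"
    unfolding det[symmetric] by (simp add: algebra_simps)
  also have "\<dots> = m * (x * x11 X + y * x21 X)"
    unfolding x y by (simp add: algebra_simps)
  finally have b: "b = x * x11 X + y * x21 X" using m by simp
  have "m * c = x22 X * (b * x12 X + c * x11 X) - x12 X * (b * x22 X - c * x21 X)"
    unfolding det[symmetric] by (simp add: algebra_simps)
  also have "\<dots> = m * (y * x22 X - x * x12 X)"
    unfolding x y by (simp add: algebra_simps)
  finally have c: "c = y * x22 X - x * x12 X" using m by simp
  have eq: "z = real_of_int x *\<^sub>R s_row1 X + real_of_int y *\<^sub>R s_row2 X"
    by (simp add: bc(1) b c s_row1_def s_row2_def)
  then show ?thesis using that z by force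
qed

section \<open>The sign change along the run\<close>

definition row_product :: "qin_mat \<Rightarrow> real" where
  "row_product X = s_row1 X \<bullet> s_row2 X"

lemma norm_reflect: "norm (b, - c) = norm (b, c)" for b c :: real
  by (simp add: norm_Pair)

lemma step_dominates:
  assumes inv: "qin_invariant a m X" and ne: "x12 X \<noteq> 1"
    and neg: "row_product X < 0" and pos: "0 \<le> row_product (qin_step X)"
    and z: "z \<in> cong_lattice a m - {0}"
  shows "\<exists>v\<in>{s_row1 X, s_row2 X, s_row1 (qin_step X), s_row2 (qin_step X)}. norm v \<le> norm z"
proof -
  note I = inv[unfolded qin_invariant_def]
  obtain x y :: int where xy: "z = real_of_int x *\<^sub>R s_row1 X + real_of_int y *\<^sub>R s_row2 X"
    "x \<noteq> 0 \<or> y \<noteq> 0"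
    using lattice_coordinates[OF inv z] .
  have step_pos: "0 < x12 (qin_step X)" "0 < x22 (qin_step X)"
    using qin_invariant_step[OF inv] by (auto simp: qin_invariant_def)
  show ?thesis
  proof (cases "x12 X < x22 X")
    case True
    define n where "n = nat ((x22 X - 1) div x12 X)"
    have n: "(x22 X - 1) div x12 X = int n"
      using I by (simp add: n_def pos_imp_zdiv_nonneg_iff)
    note step = qin_step_row2[OF ne True, unfolded n]
    have row: "s_row2 (qin_step X) = s_row2 X + real n *\<^sub>R s_row1 X"
      and row': "s_row1 (qin_step X) = s_row1 X"
      by (simp_all add: step s_row1_def s_row2_def)
    have "real_of_int (int n * x12 X) \<le> real_of_int (x22 X)"
      using step_pos unfolding step of_int_le_iff by simp
    then have "\<exists>v\<in>{s_row1 X, s_row2 X, s_row2 X + real n *\<^sub>R s_row1 X}. norm v \<le> norm z"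
      unfolding xy(1) s_row1_def s_row2_def
      using I neg pos xy(2) unfolding row_product_def row row'
      by (intro sign_change_dominates) (simp_all add: s_row1_def s_row2_def inner_commute)
    then show ?thesis unfolding row row' by blast
  next
    case False
    then have lt: "x22 X < x12 X" using qin_invariant_ne[OF inv ne] by simp
    define n where "n = nat ((x12 X - 1) div x22 X)"
    have n: "(x12 X - 1) div x22 X = int n"
      using I by (simp add: n_def pos_imp_zdiv_nonneg_iff)
    note step = qin_step_row1[OF ne lt, unfolded n]
    \<comment> \<open>Reflection in the first axis swaps the quadrants of the two rows and keeps inner products.\<close>
    define R where "R v = (fst v, - snd v)" for v :: "real \<times> real"
    have norm_R: "norm (R v) = norm v" for v
      by (cases v) (simp add: R_def norm_reflect)
    define u w where "u = (real_of_int (x21 X), - real_of_int (x22 X))"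
      and "w = (real_of_int (x11 X), real_of_int (x12 X))"
    have R: "R u = s_row2 X" "R w = s_row1 X" "R (w + real n *\<^sub>R u) = s_row1 (qin_step X)"
      "R (real_of_int y *\<^sub>R u + real_of_int x *\<^sub>R w) = z"
      by (simp_all add: R_def u_def w_def step s_row1_def s_row2_def xy(1))
    have "real_of_int (int n * x22 X) \<le> real_of_int (x12 X)"
      using step_pos unfolding step of_int_le_iff by simp
    moreover have "w \<bullet> u < 0" "0 \<le> (w + real n *\<^sub>R u) \<bullet> u"
      using neg pos by (simp_all add: row_product_def s_row1_def s_row2_def u_def w_def step algebra_simps)
    ultimately have "\<exists>v\<in>{u, w, w + real n *\<^sub>R u}.
        norm v \<le> norm (real_of_int y *\<^sub>R u + real_of_int x *\<^sub>R w)"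
      using I xy(2) unfolding u_def w_def by (intro sign_change_dominates) auto
    then have "\<exists>v\<in>{u, w, w + real n *\<^sub>R u}. norm (R v) \<le> norm z"
      using norm_R R(4) by metis
    then show ?thesis using R(1-3) by auto
  qed
qed

text \<open>
  For \<open>x12 X = 1\<close> the rows would turn acute after \<open>x22 X - 1\<close> further additions of the first row to the
  second one. The vector obtained in this way has the second coordinate \<open>1\<close> and a first coordinate of
  at least \<open>x11 X\<close>, so it is no shorter than the first row.
\<close>

lemma last_state_dominates:
  assumes inv: "qin_invariant a m X" and m: "1 < m" and one: "x12 X = 1"
    and neg: "row_product X < 0" and z: "z \<in> cong_lattice a m - {0}"
  shows "\<exists>v\<in>{s_row1 X, s_row2 X}. norm v \<le> norm z"
proof -
  note I = inv[unfolded qin_invariant_def]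
  obtain x y :: int where xy: "z = real_of_int x *\<^sub>R s_row1 X + real_of_int y *\<^sub>R s_row2 X"
    "x \<noteq> 0 \<or> y \<noteq> 0"
    using lattice_coordinates[OF inv z] .
  have "x11 X * x21 X < x22 X"
    using neg one by (simp add: row_product_def s_row1_def s_row2_def flip: of_int_mult)
  have x11: "1 \<le> x11 X"
  proof (rule ccontr)
    assume "\<not> 1 \<le> x11 X"
    then have "x11 X = 0" using I by simp
    with I one have "m dvd - 1" by simp
    with m show False by simp
  qed
  have "x22 X \<noteq> 1"
  proof
    assume "x22 X = 1"
    \<comment> \<open>Then the inner product forces \<open>x21 X = 0\<close>, so that the determinant is \<open>x11 X\<close> and \<open>m\<close> divides
        both \<open>a * x11 X\<close> and \<open>a * x11 X - 1\<close>.\<close>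
    with \<open>x11 X * x21 X < x22 X\<close> x11 I have "x21 X = 0"
      by (smt (verit) mult_le_cancel_left1 mult_pos_pos)
    with I \<open>x22 X = 1\<close> have "m dvd 1" by simp
    with m show False by simp
  qed
  define n where "n = nat (x22 X - 1)"
  have n: "int n = x22 X - 1" "1 \<le> n"
    using I \<open>x22 X \<noteq> 1\<close> by (auto simp: n_def)
  then have x22: "real_of_int (x22 X) = real n + 1" by linarith
  have new: "s_row2 X + real n *\<^sub>R s_row1 X = (real_of_int (x21 X) + n * real_of_int (x11 X), 1)"
    by (simp add: s_row1_def s_row2_def x22 one)
  have ge: "real_of_int (x11 X) \<le> real_of_int (x21 X) + n * real_of_int (x11 X)"
  proof -
    have "1 * real_of_int (x11 X) \<le> real n * real_of_int (x11 X)"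
      using n(2) x11 by (intro mult_right_mono) auto
    moreover have "0 \<le> real_of_int (x21 X)" using I by simp
    ultimately show ?thesis by linarith
  qed
  have "1 \<le> (real_of_int (x21 X) + n * real_of_int (x11 X)) * real_of_int (x11 X)"
    using ge x11 mult_mono[of 1 "real_of_int (x21 X) + n * real_of_int (x11 X)" 1 "real_of_int (x11 X)"]
    by simp
  then have "0 \<le> (s_row2 X + real n *\<^sub>R s_row1 X) \<bullet> s_row1 X"
    unfolding new by (simp add: s_row1_def one)
  then have "\<exists>v\<in>{s_row1 X, s_row2 X, s_row2 X + real n *\<^sub>R s_row1 X}. norm v \<le> norm z"
    unfolding xy(1) s_row1_def s_row2_def
    using I neg xy(2) x22 one
    by (intro sign_change_dominates) (simp_all add: row_product_def s_row1_def s_row2_def inner_commute)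
  moreover have "norm (s_row1 X) \<le> norm (s_row2 X + real n *\<^sub>R s_row1 X)"
    unfolding new unfolding s_row1_def one using ge x11 by (intro norm_Pair_mono) auto
  ultimately show ?thesis by force
qed

lemma shortest_vector_in_dominating_set:
  fixes S L :: "'a::euclidean_space set"
  assumes "finite S" "S \<noteq> {}" "S \<subseteq> L - {0}" "\<And>z. z \<in> L - {0} \<Longrightarrow> \<exists>v\<in>S. norm v \<le> norm z"
  shows "\<exists>v\<in>S. is_shortest_vector L v"
proof -
  obtain v where v: "v \<in> S" "\<And>v'. v' \<in> S \<Longrightarrow> norm v \<le> norm v'"
    using arg_min_if_finite[OF assms(1,2), of norm] by (metis not_le)
  have "norm v \<le> norm z" if "z \<in> L" "z \<noteq> 0" for z
    using assms(4)[of z] v(2) that by force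
  then show ?thesis using v(1) assms(3) by (auto simp: is_shortest_vector_def)
qed

theorem theorem4p2:
  fixes a m :: int
  assumes "1 < a" and "a < m" and "gcd a m = 1"
  shows "\<exists>k \<le> qin_steps a m.
           let v1 = s_row1 (qin_state a m k); v2 = s_row2 (qin_state a m k)
           in \<exists>v \<in> {v1, v2, v1 + v2, v1 - v2}. is_shortest_vector (cong_lattice a m) v"
proof -
  let ?L = "cong_lattice a m" and ?X = "qin_state a m" and ?N = "qin_steps a m"
  have coprime: "coprime a m"
    using assms(3) by (simp add: coprime_iff_gcd_eq_1)
  note inv = qin_invariant_state[OF assms(1,2) coprime]
  have last: "x12 (?X ?N) = 1"
    unfolding qin_steps_def using qin_terminates[OF assms(1,2) coprime] by (rule LeastI_ex)
  have running: "x12 (?X k) \<noteq> 1" if "k < ?N" for k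
    using that not_less_Least unfolding qin_steps_def by blast
  have start: "row_product (?X 0) < 0"
    using assms by (simp add: row_product_def s_row1_def s_row2_def)
  have "\<exists>k \<le> ?N. \<exists>v \<in> {s_row1 (?X k), s_row2 (?X k)}. is_shortest_vector ?L v"
  proof (cases "0 \<le> row_product (?X ?N)")
    case True
    then obtain k where k: "k < ?N" "row_product (?X k) < 0" "0 \<le> row_product (?X (Suc k))"
      using ex_least_nat_less[of "\<lambda>k. 0 \<le> row_product (?X k)" ?N] start by (force simp: not_le)
    let ?S = "{s_row1 (?X k), s_row2 (?X k), s_row1 (?X (Suc k)), s_row2 (?X (Suc k))}"
    have "\<exists>v\<in>?S. is_shortest_vector ?L v"
    proof (rule shortest_vector_in_dominating_set)
      show "?S \<subseteq> ?L - {0}"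
        using rows_in_lattice[OF inv[of k]] rows_in_lattice[OF inv[of "Suc k"]]
        by (simp only: insert_subset empty_subsetI simp_thms)
      show "\<exists>v\<in>?S. norm v \<le> norm z" if "z \<in> ?L - {0}" for z
        using step_dominates[OF inv running[OF k(1)] k(2) _ that] k(3) by simp
    qed auto
    moreover have "k \<le> ?N" "Suc k \<le> ?N" using k(1) by auto
    ultimately show ?thesis by blast
  next
    case False
    let ?S = "{s_row1 (?X ?N), s_row2 (?X ?N)}"
    have "\<exists>v\<in>?S. is_shortest_vector ?L v"
    proof (rule shortest_vector_in_dominating_set)
      show "?S \<subseteq> ?L - {0}"
        using rows_in_lattice[OF inv[of ?N]] by (simp only: insert_subset empty_subsetI simp_thms)
      show "\<exists>v\<in>?S. norm v \<le> norm z" if "z \<in> ?L - {0}" for z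
        using last_state_dominates[OF inv _ last _ that] False assms by simp
    qed auto
    then show ?thesis by blast
  qed
  then show ?thesis unfolding Let_def by blast
qed

end
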